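(* Let $\mathcal{H}$ be a real finite-dimensional Hilbert space, let $I=\{1,\dots,N\}$, for each $i\in I$ let $f_i\colon\mathcal{H}\to\mathbb{R}$ be convex and differentiable with locally Lipschitz gradient, and let $f(x)=\max_{i\in I} f_i(x)$ and $\phi(x,y)=\sum_{i\in I}y_if_i(x)$. Let $((x^k,y^k))_{k\in\mathbb{N}}\subset\mathcal{H}\times\Delta^N$ be a sequence converging to a saddle point $(x^*,y^* )$ of $\phi$ on $\mathcal{H}\times\Delta^N$, and let $\varepsilon_k:=f(x^k)-\phi(x^k,y^k)\ge 0$. Then $\varepsilon_k\to 0$ and $$\nabla_x\phi(x^k,y^k)\in\partial_{\varepsilon_k}f(x^k)\quad\text{for all }k\in\mathbb{N}.$$ Moreover, if $0\in\operatorname{ri}\partial f(x^* )$ and $\Lambda(x^* )$ is a singleton, then for any $p>1$ there exists $k_0\in\mathbb{N}$ such that $$\left\{i\in I : f(x^k)-f_i(x^k)\le\varepsilon_k^{(p-1)/p}\right\}=I(x^* )\quad\text{for all }k\ge k_0.$$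
   Context: $\Delta^N=\{y\in\mathbb{R}^N : y_i\ge 0\ \forall i,\ \sum_{i=1}^N y_i=1\}$ is the probability simplex. The active set at $x$ is $I(x)=\{i\in I: f_i(x)=f(x)\}$. $\partial f$ is the convex subdifferential, and for $\varepsilon\ge0$ the $\varepsilon$-subdifferential is $\partial_\varepsilon f(x_0)=\{\xi\in\mathcal{H} : f(x)-f(x_0)-\langle\xi,x-x_0\rangle+\varepsilon\ge0\ \forall x\in\mathcal{H}\}$ (so $\partial_0 f=\partial f$). $\operatorname{ri}$ denotes relative interior. $\nabla_x\phi(x,y)=\sum_{i\in I}y_i\nabla f_i(x)$. A pair $(x^*,y^* )\in\mathcal{H}\times\Delta^N$ is a saddle point of $\phi$ on $\mathcal{H}\times\Delta^N$ if $\phi(x^*,y)\le\phi(x^*,y^* )\le\phi(x,y^* )$ for all $(x,y)\in\mathcal{H}\times\Delta^N$. $\Lambda(x^* )=\{y\in\Delta^N : (x^*,y)\text{ is a saddle point of }\phi\text{ on }\mathcal{H}\times\Delta^N\}$. *)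

theory Defs
  imports "HOL-Analysis.Analysis"
begin

text \<open>The index set \<open>I = {1, \<dots>, N}\<close> is the universe of a finite type \<open>'n\<close>, so
  \<open>\<real>\<^sup>N\<close> is \<^typ>\<open>real ^ 'n\<close>.\<close>

definition prob_simplex :: "(real ^ 'n::finite) set" where
  "prob_simplex = {y. (\<forall>i. 0 \<le> y $ i) \<and> (\<Sum>i\<in>UNIV. y $ i) = 1}"

definition max_fun :: "('n::finite \<Rightarrow> 'a \<Rightarrow> real) \<Rightarrow> 'a \<Rightarrow> real" where
  "max_fun F x = Max (range (\<lambda>i. F i x))"

definition active_set :: "('n::finite \<Rightarrow> 'a \<Rightarrow> real) \<Rightarrow> 'a \<Rightarrow> 'n set" where
  "active_set F x = {i. F i x = max_fun F x}"

definition phi :: "('n::finite \<Rightarrow> 'a \<Rightarrow> real) \<Rightarrow> 'a \<Rightarrow> real ^ 'n \<Rightarrow> real" where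
  "phi F x y = (\<Sum>i\<in>UNIV. y $ i * F i x)"

text \<open>\<open>grad_x_phi G\<close> is \<open>\<nabla>\<^sub>x \<phi>\<close> when \<open>G i\<close> is the gradient map of the \<open>i\<close>-th function.\<close>

definition grad_x_phi ::
    "('n::finite \<Rightarrow> 'a \<Rightarrow> 'a::real_inner) \<Rightarrow> 'a \<Rightarrow> real ^ 'n \<Rightarrow> 'a" where
  "grad_x_phi G x y = (\<Sum>i\<in>UNIV. (y $ i) *\<^sub>R G i x)"

definition locally_lipschitz :: "('a::metric_space \<Rightarrow> 'b::metric_space) \<Rightarrow> bool" where
  "locally_lipschitz g \<longleftrightarrow> (\<forall>x. \<exists>u>0. \<exists>L. L-lipschitz_on (ball x u) g)"

definition eps_subdifferential :: "real \<Rightarrow> ('a::real_inner \<Rightarrow> real) \<Rightarrow> 'a \<Rightarrow> 'a set" where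
  "eps_subdifferential e f x0 = {\<xi>. \<forall>x. f x - f x0 - inner \<xi> (x - x0) + e \<ge> 0}"

definition subdifferential :: "('a::real_inner \<Rightarrow> real) \<Rightarrow> 'a \<Rightarrow> 'a set" where
  "subdifferential f x0 = {\<xi>. \<forall>x. f x \<ge> f x0 + inner \<xi> (x - x0)}"

text \<open>Minimisation in the first variable, maximisation in the second.\<close>

definition saddle_point ::
    "('a \<Rightarrow> 'b \<Rightarrow> real) \<Rightarrow> 'a set \<Rightarrow> 'b set \<Rightarrow> 'a \<Rightarrow> 'b \<Rightarrow> bool" where
  "saddle_point h X Y xs ys \<longleftrightarrow> xs \<in> X \<and> ys \<in> Y \<and>
     (\<forall>x\<in>X. \<forall>y\<in>Y. h xs y \<le> h xs ys \<and> h xs ys \<le> h x ys)"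

definition Lambda :: "('n::finite \<Rightarrow> 'a \<Rightarrow> real) \<Rightarrow> 'a \<Rightarrow> (real ^ 'n) set" where
  "Lambda F xs = {y \<in> prob_simplex. saddle_point (phi F) UNIV prob_simplex xs y}"

end

theory Submission
  imports Defs
begin

text \<open>
  For \<open>y\<close> in the simplex, \<open>\<phi> x y\<close> is a weighted average of the values \<open>F i x\<close>. It therefore
  lies below the maximum \<open>f x\<close>, with gap \<open>\<epsilon> = (\<Sum>i. y i * (f x - F i x))\<close>. The saddle property
  closes the gap at the limit, so continuity gives \<open>\<epsilon>\<^sub>k \<rightarrow> 0\<close>. The tangent inequality for the convex
  function \<open>\<phi>(\<cdot>, y\<^sup>k)\<close>, which minorises \<open>f\<close>, is precisely the \<open>\<epsilon>\<^sub>k\<close>-subgradient inequality.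

  The identification of the active set rests on strict complementarity: every active index has
  positive weight in \<open>y\<^sup>*\<close>. Suppose \<open>j\<close> is active, with gradient \<open>g\<^sub>j \<in> \<partial>f(x\<^sup>*)\<close>. As \<open>0\<close> is in the
  relative interior, \<open>- t g\<^sub>j \<in> \<partial>f(x\<^sup>*)\<close> for some \<open>t > 0\<close>; and every subgradient of \<open>f\<close> at \<open>x\<^sup>*\<close>
  is a convex combination of active gradients. Moving \<open>t g\<^sub>j\<close> to the other side and normalising
  produces a multiplier that gives \<open>j\<close> positive weight, and by uniqueness this multiplier is
  \<open>y\<^sup>*\<close>.

  Each summand of the gap is nonnegative, so \<open>y\<^sup>k\<^sub>i (f(x\<^sup>k) - F\<^sub>i(x\<^sup>k)) \<le> \<epsilon>\<^sub>k\<close>. An active index has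
  weight bounded away from \<open>0\<close>, hence a deficit of order \<open>\<epsilon>\<^sub>k\<close>, which is eventually below
  \<open>\<epsilon>\<^sub>k\<close> to the power \<open>(p - 1) / p < 1\<close>. An inactive index keeps a deficit bounded away from \<open>0\<close>,
  whereas the threshold tends to \<open>0\<close>.
\<close>

section \<open>The maximum function and averages over the simplex\<close>

lemma le_max_fun: "F i x \<le> max_fun F x"
  by (simp add: max_fun_def)

lemma active_setE:
  obtains i where "i \<in> active_set F x"
proof -
  have "max_fun F x \<in> range (\<lambda>i. F i x)"
    unfolding max_fun_def by (rule Max_in) auto
  then show thesis
    using that by (auto simp: active_set_def)
qed

lemma max_fun_minus_phi:
  assumes "y \<in> prob_simplex"
  shows "max_fun F x - phi F x y = (\<Sum>i\<in>UNIV. y $ i * (max_fun F x - F i x))"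
  using assms by (simp add: phi_def prob_simplex_def right_diff_distrib sum_subtractf
      flip: sum_distrib_right)

lemma phi_le_max_fun:
  assumes "y \<in> prob_simplex"
  shows "phi F x y \<le> max_fun F x"
proof -
  have "0 \<le> (\<Sum>i\<in>UNIV. y $ i * (max_fun F x - F i x))"
    using assms by (intro sum_nonneg mult_nonneg_nonneg) (auto simp: prob_simplex_def le_max_fun)
  then show ?thesis
    using max_fun_minus_phi[OF assms, of F x] by simp
qed

lemma weighted_deficit_le_gap:
  assumes "y \<in> prob_simplex"
  shows "y $ i * (max_fun F x - F i x) \<le> max_fun F x - phi F x y"
  unfolding max_fun_minus_phi[OF assms]
  by (rule member_le_sum) (use assms in \<open>auto simp: prob_simplex_def le_max_fun\<close>)

lemma phi_eq_max_fun:
  assumes "y \<in> prob_simplex" and "\<And>i. i \<notin> active_set F x \<Longrightarrow> y $ i = 0"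
  shows "phi F x y = max_fun F x"
proof -
  have "(\<Sum>i\<in>UNIV. y $ i * (max_fun F x - F i x)) = 0"
    using assms(2) by (intro sum.neutral) (auto simp: active_set_def)
  then show ?thesis
    using max_fun_minus_phi[OF assms(1), of F x] by simp
qed

lemma axis_in_prob_simplex: "axis j 1 \<in> prob_simplex"
  by (auto simp: prob_simplex_def axis_def)

lemma phi_axis: "phi F x (axis j 1) = F j x"
  by (simp add: phi_def axis_def if_distrib[of "\<lambda>c. c * _"] cong: if_cong)

lemma grad_x_phi_axis: "grad_x_phi G x (axis j 1) = G j x"
  by (simp add: grad_x_phi_def axis_def if_distrib[of "\<lambda>c. c *\<^sub>R _"] cong: if_cong)

lemma linear_grad_x_phi: "linear (grad_x_phi G x)"
  by (rule linearI) (simp_all add: grad_x_phi_def scaleR_left_distrib sum.distrib scaleR_sum_right)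

lemma convex_prob_simplex: "convex prob_simplex"
  by (rule convexI)
    (auto simp: prob_simplex_def sum.distrib simp flip: sum_distrib_left)

text \<open>The two-sided bound at a saddle point is attained because vertices of the simplex compete
  in the maximisation over \<open>y\<close>.\<close>

lemma saddle_value_eq_max_fun:
  assumes "saddle_point (phi F) UNIV prob_simplex xs ys"
  shows "phi F xs ys = max_fun F xs"
proof -
  obtain j where j: "j \<in> active_set F xs"
    by (rule active_setE)
  have "phi F xs (axis j 1) \<le> phi F xs ys"
    using assms axis_in_prob_simplex[of j] by (auto simp: saddle_point_def)
  moreover have "phi F xs ys \<le> max_fun F xs"
    using assms by (intro phi_le_max_fun) (auto simp: saddle_point_def)
  ultimately show ?thesis
    using j by (simp add: phi_axis active_set_def)
qed

text \<open>The maximum is \<open>1\<close>-Lipschitz for the sup-norm of the values, hence also for their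
  \<open>\<ell>\<^sup>1\<close>-norm, which is the more convenient bound for a limit.\<close>

lemma tendsto_max_fun:
  assumes "\<And>i. ((\<lambda>k. F i (x k)) \<longlongrightarrow> F i xs) net"
  shows "((\<lambda>k. max_fun F (x k)) \<longlongrightarrow> max_fun F xs) net"
proof -
  have bound: "max_fun F u - max_fun F v \<le> (\<Sum>i\<in>UNIV. \<bar>F i u - F i v\<bar>)" for u v
  proof -
    obtain i where i: "i \<in> active_set F u"
      by (rule active_setE)
    have "max_fun F u - max_fun F v \<le> F i u - F i v"
      using i le_max_fun[of F i v] by (simp add: active_set_def)
    also have "\<dots> \<le> \<bar>F i u - F i v\<bar>"
      by simp
    also have "\<dots> \<le> (\<Sum>i\<in>UNIV. \<bar>F i u - F i v\<bar>)"
      by (rule member_le_sum) auto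
    finally show ?thesis .
  qed
  have "norm (max_fun F u - max_fun F v) \<le> (\<Sum>i\<in>UNIV. \<bar>F i u - F i v\<bar>)" for u v
    using bound[of u v] bound[of v u] by (simp add: abs_minus_commute abs_le_iff)
  then have "\<forall>\<^sub>F k in net. norm (max_fun F (x k) - max_fun F xs)
      \<le> (\<Sum>i\<in>UNIV. \<bar>F i (x k) - F i xs\<bar>)"
    by (rule always_eventually[OF allI])
  moreover have "((\<lambda>k. \<Sum>i\<in>UNIV. \<bar>F i (x k) - F i xs\<bar>) \<longlongrightarrow> 0) net"
    by (intro tendsto_null_sum tendsto_rabs_zero) (use assms in \<open>simp add: LIM_zero\<close>)
  ultimately have "((\<lambda>k. max_fun F (x k) - max_fun F xs) \<longlongrightarrow> 0) net"
    by (rule Lim_null_comparison)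
  then show ?thesis
    by (rule LIM_zero_cancel)
qed

section \<open>Gradients of convex functions\<close>

lemma GDERIV_imp_DERIV_along_line:
  assumes "GDERIV f (u + s *\<^sub>R d) :> g"
  shows "((\<lambda>s. f (u + s *\<^sub>R d)) has_real_derivative inner d g) (at s)"
proof -
  have "((\<lambda>s. u + s *\<^sub>R d) has_derivative (\<lambda>h. h *\<^sub>R d)) (at s)"
    by (auto intro!: derivative_eq_intros)
  from has_derivative_compose[OF this assms[unfolded gderiv_def]]
  show ?thesis
    by (simp add: has_field_derivative_def mult_commute_abs)
qed

lemma GDERIV_imp_isCont: "GDERIV f z :> g \<Longrightarrow> isCont f z"
  using has_derivative_continuous by (auto simp: gderiv_def)

lemma convex_on_along_line:
  assumes "convex_on UNIV f"
  shows "convex_on UNIV (\<lambda>s. f (u + s *\<^sub>R d))"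
proof (rule convex_onI)
  fix t a b :: real
  assume "0 < t" "t < 1"
  have "u + ((1 - t) * a + t * b) *\<^sub>R d = (1 - t) *\<^sub>R (u + a *\<^sub>R d) + t *\<^sub>R (u + b *\<^sub>R d)"
    by (simp add: algebra_simps)
  then show "f (u + ((1 - t) *\<^sub>R a + t *\<^sub>R b) *\<^sub>R d)
      \<le> (1 - t) * f (u + a *\<^sub>R d) + t * f (u + b *\<^sub>R d)"
    using convex_onD[OF assms, of t "u + a *\<^sub>R d" "u + b *\<^sub>R d"] \<open>0 < t\<close> \<open>t < 1\<close> by simp
qed simp

lemma convex_gradient_inequality:
  assumes "convex_on UNIV f" and "GDERIV f u :> g"
  shows "f u + inner g (z - u) \<le> f z"
proof -
  have "((\<lambda>s. f (u + s *\<^sub>R (z - u))) has_real_derivative inner (z - u) g) (at 0)"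
    by (rule GDERIV_imp_DERIV_along_line) (simp add: assms)
  from convex_on_imp_above_tangent[OF convex_on_along_line[OF assms(1)] _ _ _ this, of 1]
  show ?thesis
    by (simp add: inner_commute)
qed

text \<open>Nonnegativity of the weights preserves the tangent inequality.\<close>

lemma phi_gradient_inequality:
  assumes "\<And>i. convex_on UNIV (F i)" and "\<And>i. GDERIV (F i) u :> G i u"
    and "y \<in> prob_simplex"
  shows "phi F u y + inner (grad_x_phi G u y) (z - u) \<le> phi F z y"
proof -
  have "phi F u y + inner (grad_x_phi G u y) (z - u)
      = (\<Sum>i\<in>UNIV. y $ i * (F i u + inner (G i u) (z - u)))"
    by (simp add: phi_def grad_x_phi_def inner_sum_left sum.distrib distrib_left)
  also have "\<dots> \<le> phi F z y"
    unfolding phi_def using assms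
    by (intro sum_mono mult_left_mono convex_gradient_inequality) (auto simp: prob_simplex_def)
  finally show ?thesis .
qed

text \<open>The tangent to \<open>\<phi>(\<cdot>, y)\<close> lies below \<open>f\<close> and misses it at \<open>u\<close> by exactly the gap.\<close>

lemma grad_x_phi_in_eps_subdifferential:
  assumes "\<And>i. convex_on UNIV (F i)" and "\<And>i. GDERIV (F i) u :> G i u"
    and "y \<in> prob_simplex"
  shows "grad_x_phi G u y \<in> eps_subdifferential (max_fun F u - phi F u y) (max_fun F) u"
proof -
  have "0 \<le> max_fun F z - max_fun F u - inner (grad_x_phi G u y) (z - u)
      + (max_fun F u - phi F u y)" for z
    using phi_gradient_inequality[of F u G, OF assms, of z] phi_le_max_fun[OF assms(3), of F z]
    by linarith
  then show ?thesis
    by (simp add: eps_subdifferential_def)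
qed

lemma active_gradient_in_subdifferential:
  assumes "convex_on UNIV (F j)" and "GDERIV (F j) u :> g" and "j \<in> active_set F u"
  shows "g \<in> subdifferential (max_fun F) u"
proof -
  have "max_fun F u + inner g (z - u) \<le> max_fun F z" for z
    using convex_gradient_inequality[OF assms(1,2), of z] le_max_fun[of F j z] assms(3)
    by (simp add: active_set_def)
  then show ?thesis
    by (simp add: subdifferential_def)
qed

section \<open>Subgradients of a maximum\<close>

text \<open>A compact convex set has a point \<open>c\<close> closest to \<open>\<xi>\<close>, and \<open>\<xi> - c\<close> is the normal of a
  separating hyperplane. Compactness supplies the closest point in an arbitrary real inner
  product space.\<close>

lemma separate_point_from_compact_convex:
  fixes C :: "'a::real_inner set"
  assumes "convex C" "compact C" "C \<noteq> {}" "\<xi> \<notin> C"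
  obtains d where "\<And>z. z \<in> C \<Longrightarrow> inner d z < inner d \<xi>"
proof -
  have "continuous_on C (dist \<xi>)"
    by (intro continuous_intros)
  then obtain c where c: "c \<in> C" "\<And>z. z \<in> C \<Longrightarrow> dist \<xi> c \<le> dist \<xi> z"
    using continuous_attains_inf[OF assms(2,3)] by blast
  have "inner (\<xi> - c) z < inner (\<xi> - c) \<xi>" if "z \<in> C" for z
  proof -
    have "inner (\<xi> - c) (z - c) \<le> 0"
      using any_closest_point_dot[OF assms(1) compact_imp_closed[OF assms(2)] c(1) that] c(2)
      by blast
    moreover have "0 < inner (\<xi> - c) (\<xi> - c)"
      using c(1) assms(4) by auto
    ultimately show ?thesis
      by (simp add: inner_diff_right)
  qed
  then show thesis
    by (rule that)
qed

text \<open>The inclusion of \<open>\<partial>f\<close> in the convex hull of the active gradients. If \<open>d\<close> separates a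
  subgradient \<open>\<xi>\<close> from the active gradients, then along \<open>d\<close> every active function grows more
  slowly than \<open>\<xi>\<close> demands, while the inactive ones stay below the maximum by continuity; so a
  small step along \<open>d\<close> violates the subgradient inequality.\<close>

lemma subdifferential_max_fun_subset_hull:
  fixes F :: "'n::finite \<Rightarrow> 'a::real_inner \<Rightarrow> real"
  assumes grad: "\<And>i. GDERIV (F i) u :> g i"
  shows "subdifferential (max_fun F) u \<subseteq> convex hull (g ` active_set F u)"
proof (rule subsetI, rule ccontr)
  fix \<xi> assume sub: "\<xi> \<in> subdifferential (max_fun F) u"
    and "\<xi> \<notin> convex hull (g ` active_set F u)"
  moreover have "compact (convex hull (g ` active_set F u))"
    by (simp add: finite_imp_compact_convex_hull)
  moreover obtain j where "j \<in> active_set F u"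
    by (rule active_setE)
  ultimately obtain d where
    d: "\<And>z. z \<in> convex hull (g ` active_set F u) \<Longrightarrow> inner d z < inner d \<xi>"
    using separate_point_from_compact_convex[OF convex_convex_hull] by blast
  have "\<forall>\<^sub>F t in at_right 0. F i (u + t *\<^sub>R d) < max_fun F u + t * inner d \<xi>" for i
  proof -
    let ?h = "\<lambda>t. F i (u + t *\<^sub>R d) - (max_fun F u + t * inner d \<xi>)"
    have "((\<lambda>t. F i (u + t *\<^sub>R d)) has_real_derivative inner d (g i)) (at 0)"
      by (rule GDERIV_imp_DERIV_along_line) (simp add: grad)
    then have der: "(?h has_real_derivative inner d (g i) - inner d \<xi>) (at 0)"
      by (auto intro!: derivative_eq_intros)
    have "\<forall>\<^sub>F t in at_right 0. ?h t < 0"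
    proof (cases "i \<in> active_set F u")
      case True
      then have "inner d (g i) - inner d \<xi> < 0"
        using d[of "g i"] by (simp add: hull_inc)
      then obtain e where "0 < e" "\<And>t. 0 < t \<Longrightarrow> t < e \<Longrightarrow> ?h t < ?h 0"
        using DERIV_neg_dec_right[OF der] by auto
      moreover have "?h 0 = 0"
        using True by (simp add: active_set_def)
      ultimately show ?thesis
        unfolding eventually_at_right_field by metis
    next
      case False
      then have "?h 0 < 0"
        using le_max_fun[of F i u] by (simp add: active_set_def)
      moreover have "(?h \<longlongrightarrow> ?h 0) (at_right 0)"
        using DERIV_isCont[OF der] by (simp add: isCont_def filterlim_at_split)
      ultimately show ?thesis
        by (rule order_tendstoD(2)[rotated])
    qed
    then show ?thesis
      by simp
  qed
  then have "\<forall>\<^sub>F t in at_right 0. \<forall>i. F i (u + t *\<^sub>R d) < max_fun F u + t * inner d \<xi>"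
    by (rule eventually_all_finite)
  then obtain t where t: "\<And>i. F i (u + t *\<^sub>R d) < max_fun F u + t * inner d \<xi>"
    using eventually_happens[of _ "at_right (0::real)"] by auto
  obtain i where "i \<in> active_set F (u + t *\<^sub>R d)"
    by (rule active_setE)
  then have "max_fun F (u + t *\<^sub>R d) < max_fun F u + t * inner d \<xi>"
    using t[of i] by (simp add: active_set_def)
  moreover have "max_fun F u + inner \<xi> (u + t *\<^sub>R d - u) \<le> max_fun F (u + t *\<^sub>R d)"
    using sub unfolding subdifferential_def by blast
  ultimately show False
    by (simp add: inner_commute)
qed

text \<open>Reindexing the hull by multiplier vectors: combinations of active gradients with weights
  in the simplex form a convex set, namely the linear image of a face, so the hull minimality
  principle yields weights per index even when several indices share a gradient.\<close>

lemma subgradient_of_max_fun_eq_grad_x_phi: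
  fixes F :: "'n::finite \<Rightarrow> 'a::real_inner \<Rightarrow> real"
  assumes "\<And>i. GDERIV (F i) u :> G i u" and "\<xi> \<in> subdifferential (max_fun F) u"
  obtains y where "y \<in> prob_simplex" "\<And>i. i \<notin> active_set F u \<Longrightarrow> y $ i = 0"
    "grad_x_phi G u y = \<xi>"
proof -
  let ?face = "{y \<in> prob_simplex. \<forall>i. i \<notin> active_set F u \<longrightarrow> y $ i = 0}"
  have "convex {y :: real ^ 'n. \<forall>i. i \<notin> active_set F u \<longrightarrow> y $ i = 0}"
    by (rule convexI) auto
  from convex_Int[OF convex_prob_simplex this] have "convex ?face"
    by (simp add: Int_def)
  then have "convex (grad_x_phi G u ` ?face)"
    by (rule convex_linear_image[OF linear_grad_x_phi])
  moreover have "(\<lambda>i. G i u) ` active_set F u \<subseteq> grad_x_phi G u ` ?face"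
  proof (rule image_subsetI)
    fix j assume "j \<in> active_set F u"
    then have "axis j 1 \<in> ?face"
      using axis_in_prob_simplex[of j] by (auto simp: axis_def)
    then have "grad_x_phi G u (axis j 1) \<in> grad_x_phi G u ` ?face"
      by (rule imageI)
    then show "G j u \<in> grad_x_phi G u ` ?face"
      by (simp only: grad_x_phi_axis)
  qed
  ultimately have "convex hull ((\<lambda>i. G i u) ` active_set F u) \<subseteq> grad_x_phi G u ` ?face"
    by (intro hull_minimal)
  then have "\<xi> \<in> grad_x_phi G u ` ?face"
    using subdifferential_max_fun_subset_hull[of F u "\<lambda>i. G i u", OF assms(1)] assms(2) by blast
  then show thesis
    using that by auto
qed

section \<open>Strict complementarity\<close>

text \<open>The line through \<open>0\<close> and \<open>v\<close> lies in the affine hull, where \<open>S\<close> is a neighbourhood of \<open>0\<close>.\<close>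

lemma rel_interior_zero_reflect:
  fixes S :: "'a::real_normed_vector set"
  assumes "0 \<in> rel_interior S" and "v \<in> S"
  obtains t :: real where "0 < t" "- t *\<^sub>R v \<in> S"
proof -
  obtain T where T: "open T" "0 \<in> T" "T \<inter> affine hull S \<subseteq> S" and "0 \<in> S"
    using assms(1) by (auto simp: mem_rel_interior)
  have aff: "- t *\<^sub>R v \<in> affine hull S" for t :: real
  proof -
    have "0 \<in> affine hull S" "v \<in> affine hull S"
      using \<open>0 \<in> S\<close> assms(2) by (auto simp: hull_inc)
    then show ?thesis
      using mem_affine[OF affine_affine_hull, of 0 S v "1 + t" "- t"] by simp
  qed
  have "((\<lambda>t. - t *\<^sub>R v) \<longlongrightarrow> - 0 *\<^sub>R v) (at_right (0::real))"
    by (intro tendsto_intros)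
  then have "\<forall>\<^sub>F t in at_right (0::real). - t *\<^sub>R v \<in> T"
    using T by (intro topological_tendstoD) auto
  moreover have "\<forall>\<^sub>F t in at_right (0::real). 0 < t"
    by (rule eventually_at_right_less)
  ultimately have "\<forall>\<^sub>F t in at_right (0::real). 0 < t \<and> - t *\<^sub>R v \<in> T"
    by eventually_elim simp
  then obtain t :: real where "0 < t" "- t *\<^sub>R v \<in> T"
    using eventually_happens[of _ "at_right (0::real)"] by auto
  then show thesis
    using that T(3) aff by blast
qed

text \<open>Support on the active set makes \<open>y\<close> maximal for \<open>\<phi>(x\<^sup>*, \<cdot>)\<close>; stationarity makes \<open>x\<^sup>*\<close>
  minimal for the convex function \<open>\<phi>(\<cdot>, y)\<close>.\<close>

lemma stationary_multiplier_in_Lambda: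
  assumes "\<And>i. convex_on UNIV (F i)" and "\<And>i. GDERIV (F i) xs :> G i xs"
    and y: "y \<in> prob_simplex" "\<And>i. i \<notin> active_set F xs \<Longrightarrow> y $ i = 0"
    and stationary: "grad_x_phi G xs y = 0"
  shows "y \<in> Lambda F xs"
proof -
  have "phi F xs y' \<le> phi F xs y" if "y' \<in> prob_simplex" for y'
    using phi_le_max_fun[OF that, of F xs] phi_eq_max_fun[of y F xs, OF y] by simp
  moreover have "phi F xs y \<le> phi F z y" for z
    using phi_gradient_inequality[of F xs G, OF assms(1,2) y(1), of z] stationary by simp
  ultimately show ?thesis
    using y(1) by (auto simp: Lambda_def saddle_point_def)
qed

text \<open>If \<open>w\<close> represents \<open>- t g\<^sub>j\<close>, then \<open>w + t e\<^sub>j\<close> has vanishing gradient combination and total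
  weight \<open>1 + t\<close>; the witness is its normalisation.\<close>

lemma ex_multiplier_positive_at_active:
  fixes F :: "'n::finite \<Rightarrow> 'a::real_inner \<Rightarrow> real"
  assumes convex: "\<And>i. convex_on UNIV (F i)" and grad: "\<And>i. GDERIV (F i) xs :> G i xs"
    and ri: "0 \<in> rel_interior (subdifferential (max_fun F) xs)"
    and j: "j \<in> active_set F xs"
  obtains y where "y \<in> Lambda F xs" "0 < y $ j"
proof -
  have "G j xs \<in> subdifferential (max_fun F) xs"
    by (rule active_gradient_in_subdifferential[where j = j]) (use assms in auto)
  with ri obtain t where t: "0 < t" "- t *\<^sub>R G j xs \<in> subdifferential (max_fun F) xs"
    by (rule rel_interior_zero_reflect)
  obtain w where w: "w \<in> prob_simplex" "\<And>i. i \<notin> active_set F xs \<Longrightarrow> w $ i = 0"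
    "grad_x_phi G xs w = - t *\<^sub>R G j xs"
    using subgradient_of_max_fun_eq_grad_x_phi[of F xs G, OF grad t(2)] by blast
  define y where "y = (1 / (1 + t)) *\<^sub>R w + (t / (1 + t)) *\<^sub>R axis j 1"
  have "1 / (1 + t) + t / (1 + t) = 1"
    using t(1) by (simp add: field_simps)
  then have "y \<in> prob_simplex"
    unfolding y_def using t(1)
    by (intro convexD[OF convex_prob_simplex w(1) axis_in_prob_simplex]) auto
  moreover have "y $ i = 0" if "i \<notin> active_set F xs" for i
    using that w(2) j by (auto simp: y_def axis_def)
  moreover have "grad_x_phi G xs y = 0"
    using t(1) by (simp add: y_def linear_add[OF linear_grad_x_phi]
        linear_scale[OF linear_grad_x_phi] w(3) grad_x_phi_axis)
  ultimately have "y \<in> Lambda F xs"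
    by (rule stationary_multiplier_in_Lambda[of F xs G, OF convex grad])
  moreover have "0 < y $ j"
    using t(1) w(1) by (auto simp: y_def prob_simplex_def intro!: add_nonneg_pos)
  ultimately show thesis
    by (rule that)
qed

section \<open>Identification of the active set\<close>

text \<open>Dividing by \<open>e\<^sup>q\<close> leaves the positive power \<open>e\<^sup>1\<^sup>-\<^sup>q\<close>, which tends to \<open>0\<close>. At indices where
  \<open>e k = 0\<close> both sides vanish, since \<open>0 powr q = 0\<close>.\<close>

lemma eventually_le_powr:
  fixes e :: "nat \<Rightarrow> real"
  assumes "e \<longlonglongrightarrow> 0" and "\<And>k. 0 \<le> e k" and "0 < c" and "q < 1"
  shows "\<forall>\<^sub>F k in sequentially. e k \<le> c * e k powr q"
proof -
  have "(\<lambda>k. e k powr (1 - q)) \<longlonglongrightarrow> 0"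
    using assms by (intro tendsto_zero_powrI[where b = "1 - q"]) auto
  then have "\<forall>\<^sub>F k in sequentially. e k powr (1 - q) < c"
    using assms(3) by (rule order_tendstoD)
  then show ?thesis
  proof eventually_elim
    case (elim k)
    have "e k = e k powr (1 - q) * e k powr q"
      using assms(2)[of k] by (cases "e k = 0") (auto simp flip: powr_add)
    also have "\<dots> \<le> c * e k powr q"
      using elim by (intro mult_right_mono) auto
    finally show ?case .
  qed
qed

text \<open>Both halves of the condition \<open>0 < q < 1\<close> matter: \<open>q < 1\<close> makes the threshold exceed every
  multiple of the gap, which admits the active indices, and \<open>0 < q\<close> makes it vanish, which
  rejects the others.\<close>

lemma eventually_active_set_identified:
  fixes F :: "'n::finite \<Rightarrow> 'a \<Rightarrow> real"
  assumes F_lim: "\<And>i. (\<lambda>k. F i (x k)) \<longlonglongrightarrow> F i xs" and y_lim: "y \<longlonglongrightarrow> ys"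
    and y: "\<And>k. y k \<in> prob_simplex"
    and gap: "(\<lambda>k. max_fun F (x k) - phi F (x k) (y k)) \<longlonglongrightarrow> 0"
    and pos: "\<And>i. i \<in> active_set F xs \<Longrightarrow> 0 < ys $ i"
    and q: "0 < q" "q < 1"
  shows "\<forall>\<^sub>F k in sequentially.
    {i. max_fun F (x k) - F i (x k) \<le> (max_fun F (x k) - phi F (x k) (y k)) powr q}
      = active_set F xs"
proof -
  let ?e = "\<lambda>k. max_fun F (x k) - phi F (x k) (y k)"
  have e_nonneg: "0 \<le> ?e k" for k
    using phi_le_max_fun[OF y, of F "x k"] by simp
  have "\<forall>\<^sub>F k in sequentially.
      max_fun F (x k) - F i (x k) \<le> ?e k powr q \<longleftrightarrow> i \<in> active_set F xs" for i
  proof (cases "i \<in> active_set F xs")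
    case True
    \<comment> \<open>Any positive bound below the limiting weight would do; take half of it.\<close>
    define c where "c = ys $ i / 2"
    have "0 < c" "c < ys $ i"
      using pos[OF True] by (auto simp: c_def)
    have "\<forall>\<^sub>F k in sequentially. c < y k $ i"
      using tendsto_vec_nth[OF y_lim] \<open>c < ys $ i\<close> by (rule order_tendstoD)
    moreover have "\<forall>\<^sub>F k in sequentially. ?e k \<le> c * ?e k powr q"
      using gap e_nonneg \<open>0 < c\<close> q(2) by (rule eventually_le_powr)
    ultimately show ?thesis
    proof eventually_elim
      case (elim k)
      have "c * (max_fun F (x k) - F i (x k)) \<le> y k $ i * (max_fun F (x k) - F i (x k))"
        using elim(1) le_max_fun[of F i "x k"] by (intro mult_right_mono) auto
      also have "\<dots> \<le> ?e k"
        by (rule weighted_deficit_le_gap[OF y])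
      also have "\<dots> \<le> c * ?e k powr q"
        by (rule elim(2))
      finally show ?case
        using True \<open>0 < c\<close> by simp
    qed
  next
    case False
    have "(\<lambda>k. ?e k powr q) \<longlonglongrightarrow> 0"
      using gap q(1) e_nonneg by (intro tendsto_zero_powrI[where b = q]) auto
    moreover have "(\<lambda>k. max_fun F (x k) - F i (x k)) \<longlonglongrightarrow> max_fun F xs - F i xs"
      by (intro tendsto_diff tendsto_max_fun F_lim)
    ultimately have "(\<lambda>k. max_fun F (x k) - F i (x k) - ?e k powr q)
        \<longlonglongrightarrow> max_fun F xs - F i xs - 0"
      by (rule tendsto_diff[rotated])
    moreover have "0 < max_fun F xs - F i xs - 0"
      using False le_max_fun[of F i xs] by (simp add: active_set_def)
    ultimately have "\<forall>\<^sub>F k in sequentially. 0 < max_fun F (x k) - F i (x k) - ?e k powr q"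
      by (rule order_tendstoD)
    then show ?thesis
      by eventually_elim (use False in auto)
  qed
  then have "\<forall>\<^sub>F k in sequentially. \<forall>i.
      max_fun F (x k) - F i (x k) \<le> ?e k powr q \<longleftrightarrow> i \<in> active_set F xs"
    by (rule eventually_all_finite)
  then show ?thesis
    by eventually_elim auto
qed

theorem corollary4p5:
  fixes F :: "'n::finite \<Rightarrow> 'a::real_inner \<Rightarrow> real"
    and G :: "'n \<Rightarrow> 'a \<Rightarrow> 'a"
    and x :: "nat \<Rightarrow> 'a" and y :: "nat \<Rightarrow> real ^ 'n"
    and xs :: 'a and ys :: "real ^ 'n"
    and eps :: "nat \<Rightarrow> real"
  assumes finite_dim: "\<exists>B :: 'a set. finite B \<and> span B = UNIV"
    and convex: "\<And>i. convex_on UNIV (F i)"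
    and gradient: "\<And>i z. GDERIV (F i) z :> G i z"
    and lipschitz: "\<And>i. locally_lipschitz (G i)"
    and y_simplex: "\<And>k. y k \<in> prob_simplex"
    and saddle: "saddle_point (phi F) UNIV prob_simplex xs ys"
    and lim: "(\<lambda>k. (x k, y k)) \<longlonglongrightarrow> (xs, ys)"
    and eps: "\<And>k. eps k = max_fun F (x k) - phi F (x k) (y k)"
  shows "(\<forall>k. 0 \<le> eps k) \<and>
    eps \<longlonglongrightarrow> 0 \<and>
    (\<forall>k. grad_x_phi G (x k) (y k) \<in> eps_subdifferential (eps k) (max_fun F) (x k)) \<and>
    (0 \<in> rel_interior (subdifferential (max_fun F) xs) \<and> is_singleton (Lambda F xs) \<longrightarrow>
      (\<forall>p::real. p > 1 \<longrightarrow>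
        (\<exists>k0. \<forall>k\<ge>k0.
          {i. max_fun F (x k) - F i (x k) \<le> eps k powr ((p - 1) / p)} = active_set F xs)))"
proof -
  have eps_fun: "eps = (\<lambda>k. max_fun F (x k) - phi F (x k) (y k))"
    using eps by (rule ext)
  have x_lim: "x \<longlonglongrightarrow> xs" and y_lim: "y \<longlonglongrightarrow> ys"
    using tendsto_fst[OF lim] tendsto_snd[OF lim] by simp_all
  have F_lim: "(\<lambda>k. F i (x k)) \<longlonglongrightarrow> F i xs" for i
    by (rule isCont_tendsto_compose[OF GDERIV_imp_isCont[OF gradient] x_lim])
  have "(\<lambda>k. phi F (x k) (y k)) \<longlonglongrightarrow> phi F xs ys"
    unfolding phi_def by (intro tendsto_sum tendsto_mult tendsto_vec_nth y_lim F_lim)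
  then have eps_lim: "eps \<longlonglongrightarrow> 0"
    using tendsto_diff[OF tendsto_max_fun[of F x xs, OF F_lim]] saddle_value_eq_max_fun[OF saddle]
    unfolding eps_fun by fastforce
  have "\<exists>k0. \<forall>k\<ge>k0.
      {i. max_fun F (x k) - F i (x k) \<le> eps k powr ((p - 1) / p)} = active_set F xs"
    if ri: "0 \<in> rel_interior (subdifferential (max_fun F) xs)"
      and unique: "is_singleton (Lambda F xs)" and p: "p > 1" for p :: real
  proof -
    have "ys \<in> Lambda F xs"
      using saddle by (simp add: Lambda_def saddle_point_def)
    with unique have Lambda: "Lambda F xs = {ys}"
      by (metis is_singleton_the_elem singletonD)
    have "0 < ys $ j" if "j \<in> active_set F xs" for j
      using ex_multiplier_positive_at_active[of F xs G, OF convex gradient ri that] Lambda by auto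
    then have "\<forall>\<^sub>F k in sequentially.
        {i. max_fun F (x k) - F i (x k) \<le> eps k powr ((p - 1) / p)} = active_set F xs"
      unfolding eps_fun using p eps_lim
      by (intro eventually_active_set_identified[where F = F and xs = xs, OF F_lim y_lim y_simplex])
        (auto simp: eps_fun)
    then show ?thesis
      by (simp add: eventually_sequentially)
  qed
  moreover have "grad_x_phi G (x k) (y k) \<in> eps_subdifferential (eps k) (max_fun F) (x k)" for k
    unfolding eps by (rule grad_x_phi_in_eps_subdifferential[OF convex gradient y_simplex])
  moreover have "0 \<le> eps k" for k
    using phi_le_max_fun[OF y_simplex, of F "x k"] by (simp add: eps)
  ultimately show ?thesis
    using eps_lim by blast
qed

end
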